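(* Fix a norm $\alpha_0$ on $V$. The finite-distance component $\mathscr N_{\alpha_0}(V)$ contains a $G$-invariant norm if and only if the orbit $G\alpha_0$ is bounded for the Goldman--Iwahori metric $d_\infty$, i.e. if and only if $\sup_{g\in G}d_\infty(\alpha_0,g\alpha_0)<\infty$.
   Context: Let $F$ and $E$ be finite extensions of $\mathbb Q_p$, with a fixed (non-Archimedean, nontrivial) absolute value $|\cdot|$ on $E$. Let $\mathbb G$ be a reductive group over $F$ and $G=\mathbb G(F)$. Let $\pi_{\mathrm{sm}}$ be a smooth admissible $E$-representation of $G$, let $\sigma_{\mathrm{alg}}$ be a finite-dimensional algebraic $E$-representation of $\operatorname{Res}_{F/\mathbb Q_p}\mathbb G$ (viewed as a representation of $G$), and put $V=\pi_{\mathrm{sm}}\otimes_E\sigma_{\mathrm{alg}}$ with the diagonal $G$-action. A norm on $V$ is a function $\alpha:V\to\mathbb R_{\ge0}$ with $\alpha(\lambda v)=|\lambda|\alpha(v)$, $\alpha(v+w)\le\max\{\alpha(v),\alpha(w)\}$ for $\lambda\in E$, $v,w\in V$, and $\alpha(v)=0\Rightarrow v=0$. For norms $\alpha,\beta$ put $d_\infty(\alpha,\beta)=\sup_{v\in V\setminus\{0\}}\left|\log\frac{\alpha(v)}{\beta(v)}\right|\in[0,+\infty]$ (an extended metric). The finite-distance component of $\alpha_0$ is $\mathscr N_{\alpha_0}(V)=\{\alpha:\ d_\infty(\alpha,\alpha_0)<\infty\}$. The group $G$ acts on norms by $(g\alpha)(v)=\alpha(g^{-1}v)$; a norm is $G$-invariant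 if $g\alpha=\alpha$ for all $g\in G$. *)

theory Defs
  imports
    "HOL-Algebra.Algebraic_Closure_Type"
    "HOL-Algebra.Coset"
    "HOL-Analysis.Analysis"
    "HOL-Library.Poly_Mapping"
    "Berlekamp_Zassenhaus.Finite_Field"
begin

hide_const (open) Divisibility.prime
no_notation var (\<open>X\<index>\<close>)

section \<open>The field of p-adic numbers\<close>

definition rat_padic_abs :: "nat \<Rightarrow> rat \<Rightarrow> real"
  where "rat_padic_abs p x =
    (if x = 0 then 0
     else real p powi (int (multiplicity (int p) (snd (quotient_of x)))
                       - int (multiplicity (int p) (fst (quotient_of x)))))"

lemma rat_padic_abs_frac:
  assumes p: "prime p" and a: "a \<noteq> 0" and b: "b \<noteq> 0"
  shows "rat_padic_abs p (of_int a / of_int b) =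
    real p powi (int (multiplicity (int p) b) - int (multiplicity (int p) a))"
proof -
  define x where "x = (of_int a / of_int b :: rat)"
  obtain c d where cd: "quotient_of x = (c, d)" by force
  have d: "d > 0" using quotient_of_denom_pos[OF cd] .
  have x: "x = of_int c / of_int d" using quotient_of_div[OF cd] .
  have x0: "x \<noteq> 0" using a b by (simp add: x_def)
  with x have c: "c \<noteq> 0" by auto
  have "(of_int (a * d) :: rat) = of_int (c * b)"
    using x b d unfolding x_def by (simp add: field_simps)
  then have eq: "a * d = c * b" by (simp only: of_int_eq_iff)
  have pe: "prime_elem (int p)" using p by auto
  have "multiplicity (int p) a + multiplicity (int p) d = multiplicity (int p) c + multiplicity (int p) b"
    using arg_cong[OF eq, of "multiplicity (int p)"] a b c d pe
    by (simp add: prime_elem_multiplicity_mult_distrib)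
  then have "int (multiplicity (int p) d) - int (multiplicity (int p) c)
      = int (multiplicity (int p) b) - int (multiplicity (int p) a)" by linarith
  then show ?thesis using x0 cd unfolding rat_padic_abs_def x_def[symmetric] by simp
qed

lemma rat_padic_abs_0 [simp]: "rat_padic_abs p 0 = 0"
  by (simp add: rat_padic_abs_def)

lemma rat_padic_abs_pos: "prime p \<Longrightarrow> x \<noteq> 0 \<Longrightarrow> rat_padic_abs p x > 0"
  by (simp add: rat_padic_abs_def prime_gt_0_nat)

lemma rat_padic_abs_nonneg: "prime p \<Longrightarrow> rat_padic_abs p x \<ge> 0"
  by (cases "x = 0") (auto dest: rat_padic_abs_pos)

lemma rat_frac_cases: obtains a b where "(x :: rat) = of_int a / of_int b" "b \<noteq> 0"
  using quotient_of_div[of x] quotient_of_denom_pos[of x]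
  by (metis less_irrefl surj_pair)

lemma rat_padic_abs_mult:
  assumes p: "prime p"
  shows "rat_padic_abs p (x * y) = rat_padic_abs p x * rat_padic_abs p y"
proof (cases "x = 0 \<or> y = 0")
  case False
  obtain a b where x: "x = of_int a / of_int b" and b: "b \<noteq> 0" by (rule rat_frac_cases)
  obtain c d where y: "y = of_int c / of_int d" and d: "d \<noteq> 0" by (rule rat_frac_cases)
  have a: "a \<noteq> 0" and c: "c \<noteq> 0" using False x y by auto
  have pe: "prime_elem (int p)" and p0: "real p \<noteq> 0" using p by (auto simp: prime_gt_0_nat)
  have xy: "x * y = of_int (a * c) / of_int (b * d)" using x y by simp
  show ?thesis
    unfolding xy unfolding x y
    by (subst (1 2 3) rat_padic_abs_frac)
       (use p p0 pe a b c d in \<open>auto simp: prime_elem_multiplicity_mult_distrib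
          power_int_add[symmetric] algebra_simps\<close>)
qed auto

lemma rat_padic_abs_add:
  assumes p: "prime p"
  shows "rat_padic_abs p (x + y) \<le> max (rat_padic_abs p x) (rat_padic_abs p y)"
proof (cases "x = 0 \<or> y = 0 \<or> x + y = 0")
  case True
  then show ?thesis using rat_padic_abs_nonneg[OF p] by (auto simp: le_max_iff_disj)
next
  case False
  obtain a b where x: "x = of_int a / of_int b" and b: "b \<noteq> 0" by (rule rat_frac_cases)
  obtain c d where y: "y = of_int c / of_int d" and d: "d \<noteq> 0" by (rule rat_frac_cases)
  have x': "x = of_int (a * d) / of_int (b * d)" and y': "y = of_int (c * b) / of_int (b * d)"
    using x y b d by auto
  have s: "x + y = of_int (a * d + c * b) / of_int (b * d)"
    unfolding x' y' by (simp add: add_divide_distrib)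
  have ad: "a * d \<noteq> 0" and cb: "c * b \<noteq> 0" and bd: "b * d \<noteq> 0" using False x y b d by auto
  have n0: "a * d + c * b \<noteq> 0" using False s by (metis div_0 of_int_0)
  have p1: "real p \<ge> 1" using p prime_ge_1_nat by simp
  have nu: "\<not> is_unit (int p)" using p by auto
  let ?m = "multiplicity (int p)"
  have "int p ^ min (?m (a * d)) (?m (c * b)) dvd a * d + c * b"
    by (intro dvd_add; rule multiplicity_dvd') auto
  then have "min (?m (a * d)) (?m (c * b)) \<le> ?m (a * d + c * b)"
    using n0 nu by (intro multiplicity_geI) auto
  then have "?m (a * d) \<le> ?m (a * d + c * b) \<or> ?m (c * b) \<le> ?m (a * d + c * b)"
    by linarith
  then show ?thesis
    unfolding s unfolding x' y'
    unfolding rat_padic_abs_frac[OF p n0 bd] rat_padic_abs_frac[OF p ad bd]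
      rat_padic_abs_frac[OF p cb bd] le_max_iff_disj
    using p1 by (auto intro!: power_int_increasing)
qed

lemma rat_padic_abs_1 [simp]: "prime p \<Longrightarrow> rat_padic_abs p 1 = 1"
  by (simp add: rat_padic_abs_def)

lemma rat_padic_abs_minus [simp]:
  assumes p: "prime p" shows "rat_padic_abs p (- x) = rat_padic_abs p x"
proof -
  have "rat_padic_abs p (-1) * rat_padic_abs p (-1) = 1"
    using rat_padic_abs_mult[OF p, of "-1" "-1"] p by simp
  then have "rat_padic_abs p (-1) = 1"
    using rat_padic_abs_nonneg[OF p, of "-1"] by (metis abs_of_nonneg abs_square_eq_1 power2_eq_square)
  then show ?thesis using rat_padic_abs_mult[OF p, of "-1" x] by simp
qed

lemma rat_padic_abs_inverse:
  assumes p: "prime p" shows "rat_padic_abs p (inverse x) = inverse (rat_padic_abs p x)"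
proof (cases "x = 0")
  case False
  then have "rat_padic_abs p (inverse x) * rat_padic_abs p x = 1"
    using rat_padic_abs_mult[OF p, of "inverse x" x] p by simp
  then show ?thesis by (metis inverse_unique mult.commute)
qed simp

lemma rat_padic_abs_triangle:
  assumes p: "prime p"
  shows "rat_padic_abs p (x + y) \<le> rat_padic_abs p x + rat_padic_abs p y"
  using rat_padic_abs_add[OF p, of x y] rat_padic_abs_nonneg[OF p, of x] rat_padic_abs_nonneg[OF p, of y]
  by linarith

lemma rat_padic_abs_diff_commute:
  "prime p \<Longrightarrow> rat_padic_abs p (x - y) = rat_padic_abs p (y - x)"
  using rat_padic_abs_minus[of p "x - y"] by simp

lemma rat_padic_abs_abs_diff:
  assumes p: "prime p"
  shows "\<bar>rat_padic_abs p x - rat_padic_abs p y\<bar> \<le> rat_padic_abs p (x - y)"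
  using rat_padic_abs_triangle[OF p, of "x - y" y] rat_padic_abs_triangle[OF p, of "y - x" x]
    rat_padic_abs_diff_commute[OF p, of x y] by simp

definition padic_cauchy :: "nat \<Rightarrow> (nat \<Rightarrow> rat) \<Rightarrow> bool"
  where "padic_cauchy p X \<longleftrightarrow>
    (\<forall>r>0. \<exists>N. \<forall>m\<ge>N. \<forall>n\<ge>N. rat_padic_abs p (X m - X n) < r)"

definition padic_null :: "nat \<Rightarrow> (nat \<Rightarrow> rat) \<Rightarrow> bool"
  where "padic_null p X \<longleftrightarrow> (\<lambda>n. rat_padic_abs p (X n)) \<longlonglongrightarrow> 0"

definition padic_rel :: "nat \<Rightarrow> (nat \<Rightarrow> rat) \<Rightarrow> (nat \<Rightarrow> rat) \<Rightarrow> bool"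
  where "padic_rel p X Y \<longleftrightarrow> padic_cauchy p X \<and> padic_cauchy p Y \<and> padic_null p (\<lambda>n. X n - Y n)"

lemma padic_null_bound:
  assumes "prime p" "g \<longlonglongrightarrow> 0" "\<And>n. rat_padic_abs p (X n) \<le> g n"
  shows "padic_null p X"
  unfolding padic_null_def
  by (rule tendsto_sandwich[OF _ _ tendsto_const assms(2)])
     (use assms rat_padic_abs_nonneg in auto)

lemma padic_null_add:
  assumes "prime p" "padic_null p X" "padic_null p Y"
  shows "padic_null p (\<lambda>n. X n + Y n)"
proof (rule padic_null_bound[OF assms(1)])
  show "(\<lambda>n. rat_padic_abs p (X n) + rat_padic_abs p (Y n)) \<longlonglongrightarrow> 0"
    using tendsto_add[OF assms(2,3)[unfolded padic_null_def]] by simp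
qed (rule rat_padic_abs_triangle[OF assms(1)])

lemma padic_null_minus:
  "prime p \<Longrightarrow> padic_null p X \<Longrightarrow> padic_null p (\<lambda>n. - X n)"
  by (simp add: padic_null_def)

lemma padic_cauchy_const [simp]: "padic_cauchy p (\<lambda>n. c)"
  by (simp add: padic_cauchy_def)

lemma padic_cauchy_minus: "prime p \<Longrightarrow> padic_cauchy p X \<Longrightarrow> padic_cauchy p (\<lambda>n. - X n)"
  unfolding padic_cauchy_def
  by (metis (no_types, opaque_lifting) minus_diff_minus rat_padic_abs_minus)

lemma padic_cauchy_add:
  assumes p: "prime p" and X: "padic_cauchy p X" and Y: "padic_cauchy p Y"
  shows "padic_cauchy p (\<lambda>n. X n + Y n)"
  unfolding padic_cauchy_def
proof (intro allI impI)
  fix r :: real assume e: "r > 0"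
  obtain M where M: "\<And>m n. m \<ge> M \<Longrightarrow> n \<ge> M \<Longrightarrow> rat_padic_abs p (X m - X n) < r"
    using X e unfolding padic_cauchy_def by blast
  obtain N where N: "\<And>m n. m \<ge> N \<Longrightarrow> n \<ge> N \<Longrightarrow> rat_padic_abs p (Y m - Y n) < r"
    using Y e unfolding padic_cauchy_def by blast
  have "rat_padic_abs p (X m + Y m - (X n + Y n)) < r" if "m \<ge> max M N" "n \<ge> max M N" for m n
    using rat_padic_abs_add[OF p, of "X m - X n" "Y m - Y n"] M[of m n] N[of m n] that
    by (auto simp: algebra_simps)
  then show "\<exists>N. \<forall>m\<ge>N. \<forall>n\<ge>N. rat_padic_abs p (X m + Y m - (X n + Y n)) < r" by blast
qed

lemma padic_cauchy_bounded:
  assumes p: "prime p" and X: "padic_cauchy p X"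
  obtains B where "B > 0" "\<And>n. rat_padic_abs p (X n) \<le> B"
proof -
  obtain M where M: "\<And>m n. m \<ge> M \<Longrightarrow> n \<ge> M \<Longrightarrow> rat_padic_abs p (X m - X n) < 1"
    using X zero_less_one unfolding padic_cauchy_def by blast
  define B where "B = Max ((\<lambda>n. rat_padic_abs p (X n)) ` {..M}) + 1"
  have le: "rat_padic_abs p (X n) \<le> B - 1" if "n \<le> M" for n
    using that unfolding B_def by auto
  have "rat_padic_abs p (X n) \<le> B" for n
  proof (cases "n \<le> M")
    case False
    have "rat_padic_abs p (X n) \<le> rat_padic_abs p (X n - X M) + rat_padic_abs p (X M)"
      using rat_padic_abs_triangle[OF p, of "X n - X M" "X M"] by simp
    then show ?thesis using M[of n M] le[of M] False by auto
  qed (use le[of n] in linarith)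
  moreover have "B > 0" using le[of M] rat_padic_abs_nonneg[OF p, of "X M"] by simp
  ultimately show ?thesis using that by blast
qed

lemma padic_cauchy_mult:
  assumes p: "prime p" and X: "padic_cauchy p X" and Y: "padic_cauchy p Y"
  shows "padic_cauchy p (\<lambda>n. X n * Y n)"
  unfolding padic_cauchy_def
proof (intro allI impI)
  fix r :: real assume e: "r > 0"
  obtain B where B: "B > 0" "\<And>n. rat_padic_abs p (X n) \<le> B" by (rule padic_cauchy_bounded[OF p X]) blast
  obtain C where C: "C > 0" "\<And>n. rat_padic_abs p (Y n) \<le> C" by (rule padic_cauchy_bounded[OF p Y]) blast
  obtain M where M: "\<And>m n. m \<ge> M \<Longrightarrow> n \<ge> M \<Longrightarrow> rat_padic_abs p (X m - X n) < r / C"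
    using X e C divide_pos_pos unfolding padic_cauchy_def by meson
  obtain N where N: "\<And>m n. m \<ge> N \<Longrightarrow> n \<ge> N \<Longrightarrow> rat_padic_abs p (Y m - Y n) < r / B"
    using Y e B divide_pos_pos unfolding padic_cauchy_def by meson
  have "rat_padic_abs p (X m * Y m - X n * Y n) < r" if mn: "m \<ge> max M N" "n \<ge> max M N" for m n
  proof -
    have "rat_padic_abs p (X m - X n) * rat_padic_abs p (Y m) \<le> rat_padic_abs p (X m - X n) * C"
      using C rat_padic_abs_nonneg[OF p] by (intro mult_left_mono) auto
    also have "\<dots> < r" using M[of m n] mn C by (simp add: pos_less_divide_eq)
    finally have 1: "rat_padic_abs p ((X m - X n) * Y m) < r" by (simp add: rat_padic_abs_mult[OF p])
    have "rat_padic_abs p (X n) * rat_padic_abs p (Y m - Y n) \<le> B * rat_padic_abs p (Y m - Y n)"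
      using B rat_padic_abs_nonneg[OF p] by (intro mult_right_mono) auto
    also have "\<dots> < r" using N[of m n] mn B by (simp add: pos_less_divide_eq mult.commute)
    finally have 2: "rat_padic_abs p (X n * (Y m - Y n)) < r" by (simp add: rat_padic_abs_mult[OF p])
    have "X m * Y m - X n * Y n = (X m - X n) * Y m + X n * (Y m - Y n)" by (simp add: algebra_simps)
    then show ?thesis using rat_padic_abs_add[OF p, of "(X m - X n) * Y m" "X n * (Y m - Y n)"] 1 2 by simp
  qed
  then show "\<exists>N. \<forall>m\<ge>N. \<forall>n\<ge>N. rat_padic_abs p (X m * Y m - X n * Y n) < r" by blast
qed

lemma padic_null_mult_bounded:
  assumes p: "prime p" and X: "padic_null p X" and Y: "\<And>n. rat_padic_abs p (Y n) \<le> B"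
  shows "padic_null p (\<lambda>n. X n * Y n)"
proof (rule padic_null_bound[OF p])
  show "(\<lambda>n. rat_padic_abs p (X n) * B) \<longlonglongrightarrow> 0"
    using X unfolding padic_null_def by (rule tendsto_mult_left_zero)
  show "rat_padic_abs p (X n * Y n) \<le> rat_padic_abs p (X n) * B" for n
    using Y rat_padic_abs_nonneg[OF p] by (simp add: rat_padic_abs_mult[OF p] mult_left_mono)
qed

lemma padic_cauchy_not_null:
  assumes p: "prime p" and X: "padic_cauchy p X" and nn: "\<not> padic_null p X"
  obtains b N where "b > 0" "\<And>n. n \<ge> N \<Longrightarrow> rat_padic_abs p (X n) \<ge> b"
proof -
  obtain r where e: "r > 0" and inf: "\<And>N. \<exists>n\<ge>N. rat_padic_abs p (X n) \<ge> r"
    using nn rat_padic_abs_nonneg[OF p] unfolding padic_null_def LIMSEQ_iff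
    by (auto simp: not_less)
  obtain N where N: "\<And>m n. m \<ge> N \<Longrightarrow> n \<ge> N \<Longrightarrow> rat_padic_abs p (X m - X n) < r / 2"
    using X e half_gt_zero unfolding padic_cauchy_def by meson
  obtain k where k: "k \<ge> N" "rat_padic_abs p (X k) \<ge> r" using inf by blast
  have "rat_padic_abs p (X n) \<ge> r / 2" if "n \<ge> N" for n
    using rat_padic_abs_triangle[OF p, of "X k - X n" "X n"] N[of k n] k that
    by simp
  then show ?thesis using e that[of "r / 2" N] by simp
qed

lemma padic_cauchy_inverse:
  assumes p: "prime p" and X: "padic_cauchy p X" and nn: "\<not> padic_null p X"
  shows "padic_cauchy p (\<lambda>n. inverse (X n))"
  unfolding padic_cauchy_def
proof (intro allI impI)
  fix r :: real assume e: "r > 0"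
  obtain b M where b: "b > 0" "\<And>n. n \<ge> M \<Longrightarrow> rat_padic_abs p (X n) \<ge> b"
    by (rule padic_cauchy_not_null[OF p X nn]) blast
  obtain N where N: "\<And>m n. m \<ge> N \<Longrightarrow> n \<ge> N \<Longrightarrow> rat_padic_abs p (X m - X n) < r * b * b"
    using X e b mult_pos_pos unfolding padic_cauchy_def by meson
  have "rat_padic_abs p (inverse (X m) - inverse (X n)) < r"
    if mn: "m \<ge> max M N" "n \<ge> max M N" for m n
  proof -
    have bm: "rat_padic_abs p (X m) \<ge> b" "rat_padic_abs p (X n) \<ge> b" using b mn by auto
    then have nz: "X m \<noteq> 0" "X n \<noteq> 0" using b(1) by auto
    have "inverse (X m) - inverse (X n) = (X n - X m) * inverse (X m) * inverse (X n)"
      using nz by (simp add: field_simps)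
    then have eq: "rat_padic_abs p (inverse (X m) - inverse (X n))
      = rat_padic_abs p (X n - X m) / (rat_padic_abs p (X m) * rat_padic_abs p (X n))"
      by (simp add: rat_padic_abs_mult[OF p] rat_padic_abs_inverse[OF p] divide_inverse)
    have "b * b \<le> rat_padic_abs p (X m) * rat_padic_abs p (X n)"
      using bm b(1) by (intro mult_mono) auto
    then have "r * (b * b) \<le> r * (rat_padic_abs p (X m) * rat_padic_abs p (X n))"
      using e by (intro mult_left_mono) auto
    moreover have "rat_padic_abs p (X n - X m) < r * b * b" using N mn by simp
    moreover have "rat_padic_abs p (X m) * rat_padic_abs p (X n) > 0"
      using bm b(1) by (intro mult_pos_pos) linarith+
    ultimately show ?thesis unfolding eq by (simp add: pos_divide_less_eq mult.assoc)
  qed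
  then show "\<exists>N. \<forall>m\<ge>N. \<forall>n\<ge>N. rat_padic_abs p (inverse (X m) - inverse (X n)) < r" by blast
qed

lemma padic_rel_mult:
  assumes p: "prime p" and X: "padic_rel p X X'" and Y: "padic_rel p Y Y'"
  shows "padic_rel p (\<lambda>n. X n * Y n) (\<lambda>n. X' n * Y' n)"
proof -
  have c: "padic_cauchy p X" "padic_cauchy p X'" "padic_cauchy p Y" "padic_cauchy p Y'"
    and n: "padic_null p (\<lambda>n. X n - X' n)" "padic_null p (\<lambda>n. Y n - Y' n)"
    using X Y by (auto simp: padic_rel_def)
  obtain B where B: "\<And>n. rat_padic_abs p (Y n) \<le> B" by (rule padic_cauchy_bounded[OF p c(3)]) blast
  obtain C where C: "\<And>n. rat_padic_abs p (X' n) \<le> C" by (rule padic_cauchy_bounded[OF p c(2)]) blast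
  have "padic_null p (\<lambda>n. (X n - X' n) * Y n + (Y n - Y' n) * X' n)"
    by (rule padic_null_add[OF p padic_null_mult_bounded[OF p n(1) B] padic_null_mult_bounded[OF p n(2) C]])
  also have "(\<lambda>n. (X n - X' n) * Y n + (Y n - Y' n) * X' n) = (\<lambda>n. X n * Y n - X' n * Y' n)"
    by (auto simp: algebra_simps)
  finally show ?thesis using c p by (simp add: padic_rel_def padic_cauchy_mult)
qed

lemma padic_null_rel:
  assumes p: "prime p" and "padic_rel p X Y" shows "padic_null p X \<longleftrightarrow> padic_null p Y"
  using assms(2) padic_null_add[OF p, of "\<lambda>n. X n - Y n" Y]
    padic_null_add[OF p, of X "\<lambda>n. - (X n - Y n)"] padic_null_minus[OF p, of "\<lambda>n. X n - Y n"]
  by (auto simp: padic_rel_def)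

lemma padic_rel_sym: "prime p \<Longrightarrow> padic_rel p X Y \<Longrightarrow> padic_rel p Y X"
  using padic_null_minus[of p "\<lambda>n. X n - Y n"] by (simp add: padic_rel_def)

lemma padic_rel_inverse:
  assumes p: "prime p" and X: "padic_rel p X X'" and nn: "\<not> padic_null p X"
  shows "padic_rel p (\<lambda>n. inverse (X n)) (\<lambda>n. inverse (X' n))"
proof -
  have nn': "\<not> padic_null p X'" using padic_null_rel[OF p X] nn by simp
  have c: "padic_cauchy p X" "padic_cauchy p X'" and n: "padic_null p (\<lambda>n. X n - X' n)"
    using X by (auto simp: padic_rel_def)
  have ci: "padic_cauchy p (\<lambda>n. inverse (X n))" "padic_cauchy p (\<lambda>n. inverse (X' n))"
    using padic_cauchy_inverse[OF p] c nn nn' by auto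
  obtain b M where b: "b > 0" "\<And>n. n \<ge> M \<Longrightarrow> rat_padic_abs p (X n) \<ge> b"
    by (rule padic_cauchy_not_null[OF p c(1) nn]) blast
  obtain b' M' where b': "b' > 0" "\<And>n. n \<ge> M' \<Longrightarrow> rat_padic_abs p (X' n) \<ge> b'"
    by (rule padic_cauchy_not_null[OF p c(2) nn']) blast
  obtain B where B: "\<And>n. rat_padic_abs p (inverse (X n)) \<le> B"
    by (rule padic_cauchy_bounded[OF p ci(1)]) blast
  obtain B' where B': "\<And>n. rat_padic_abs p (inverse (X' n)) \<le> B'"
    by (rule padic_cauchy_bounded[OF p ci(2)]) blast
  have "padic_null p (\<lambda>n. - (X n - X' n) * inverse (X n) * inverse (X' n))"
    by (intro padic_null_mult_bounded[where B = B] padic_null_mult_bounded[where B = B']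
          p padic_null_minus n B B')
  moreover have "\<forall>\<^sub>F n in sequentially. rat_padic_abs p (- (X n - X' n) * inverse (X n) * inverse (X' n))
      = rat_padic_abs p (inverse (X n) - inverse (X' n))"
  proof (rule eventually_sequentiallyI[of "max M M'"])
    fix n assume n: "n \<ge> max M M'"
    then have "X n \<noteq> 0" "X' n \<noteq> 0" using b b' by (metis rat_padic_abs_0 linorder_not_le max.bounded_iff)+
    then have "- (X n - X' n) * inverse (X n) * inverse (X' n) = inverse (X n) - inverse (X' n)"
      by (simp add: field_simps)
    then show "rat_padic_abs p (- (X n - X' n) * inverse (X n) * inverse (X' n))
      = rat_padic_abs p (inverse (X n) - inverse (X' n))" by simp
  qed
  ultimately have "padic_null p (\<lambda>n. inverse (X n) - inverse (X' n))"
    unfolding padic_null_def by (subst tendsto_cong[symmetric]) auto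
  then show ?thesis using ci by (simp add: padic_rel_def)
qed

lemma part_equivp_padic_rel:
  assumes p: "prime p" shows "part_equivp (padic_rel p)"
proof (rule part_equivpI)
  show "\<exists>X. padic_rel p X X"
    by (rule exI[of _ "\<lambda>_. 0"]) (simp add: padic_rel_def padic_null_def)
  show "symp (padic_rel p)" by (auto intro: sympI padic_rel_sym[OF p])
  show "transp (padic_rel p)"
  proof (rule transpI)
    fix X Y Z assume "padic_rel p X Y" "padic_rel p Y Z"
    then show "padic_rel p X Z"
      using padic_null_add[OF p, of "\<lambda>n. X n - Y n" "\<lambda>n. Y n - Z n"] by (simp add: padic_rel_def)
  qed
qed

text \<open>The completion of the rationals for the p-adic absolute value, where p is the
  (prime) cardinality of the index type.\<close>

typedef (overloaded) ('p :: prime_card) padic =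
  "{{Y. padic_rel CARD('p) X Y} | X. padic_rel CARD('p) X X}"
proof -
  have "padic_rel CARD('p) (\<lambda>_. 0) (\<lambda>_. 0)" by (simp add: padic_rel_def padic_null_def)
  then show ?thesis by blast
qed

definition padic_class :: "(nat \<Rightarrow> rat) \<Rightarrow> 'p :: prime_card padic"
  where "padic_class X = Abs_padic {Y. padic_rel CARD('p) X Y}"

definition padic_rep :: "'p :: prime_card padic \<Rightarrow> nat \<Rightarrow> rat"
  where "padic_rep x = (SOME X. X \<in> Rep_padic x)"

definition cr_padic :: "(nat \<Rightarrow> rat) \<Rightarrow> 'p :: prime_card padic \<Rightarrow> bool"
  where "cr_padic X x \<longleftrightarrow> padic_rel CARD('p) X X \<and> padic_class X = x"

lemma Quotient_padic:
  "Quotient (padic_rel CARD('p)) (padic_class :: _ \<Rightarrow> 'p :: prime_card padic) padic_rep cr_padic"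
proof -
  let ?R = "padic_rel CARD('p)"
  have pe: "part_equivp ?R" by (rule part_equivp_padic_rel[OF prime_card])
  have sym: "?R X Y \<Longrightarrow> ?R Y X" for X Y using pe by (metis part_equivp_symp)
  have trans: "?R X Y \<Longrightarrow> ?R Y Z \<Longrightarrow> ?R X Z" for X Y Z using pe by (metis part_equivp_transp)
  have Rep: "Rep_padic (padic_class X :: 'p padic) = {Y. ?R X Y}" if "?R X X" for X
    unfolding padic_class_def using that by (intro Abs_padic_inverse) blast
  have rep: "?R (padic_rep x) (padic_rep x) \<and> padic_class (padic_rep x) = x" for x :: "'p padic"
  proof -
    obtain X where X: "Rep_padic x = {Y. ?R X Y}" "?R X X" using Rep_padic[of x] by blast
    have "padic_rep x \<in> Rep_padic x" unfolding padic_rep_def by (rule someI[of _ X]) (simp add: X)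
    then have r: "?R X (padic_rep x)" by (simp add: X)
    then have "{Y. ?R (padic_rep x) Y} = Rep_padic x" unfolding X(1) using sym trans by blast
    then have "padic_class (padic_rep x) = x" unfolding padic_class_def by (simp add: Rep_padic_inverse)
    with r show ?thesis using sym trans by blast
  qed
  show ?thesis
  proof (rule QuotientI)
    show "padic_class (padic_rep x) = x" for x :: "'p padic" using rep by blast
    show "?R (padic_rep x) (padic_rep x)" for x :: "'p padic" using rep by blast
    show "?R r s \<longleftrightarrow> ?R r r \<and> ?R s s \<and> (padic_class r :: 'p padic) = padic_class s" for r s
    proof
      assume rs: "?R r s"
      then have "{Y. ?R r Y} = {Y. ?R s Y}" using sym trans by blast
      with rs show "?R r r \<and> ?R s s \<and> (padic_class r :: 'p padic) = padic_class s"
        unfolding padic_class_def using sym trans by metis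
    next
      assume "?R r r \<and> ?R s s \<and> (padic_class r :: 'p padic) = padic_class s"
      then have "{Y. ?R r Y} = {Y. ?R s Y}" "?R s s" using Rep by metis+
      then show "?R r s" by blast
    qed
    show "(cr_padic :: _ \<Rightarrow> 'p padic \<Rightarrow> _) = (\<lambda>x y. ?R x x \<and> padic_class x = y)"
      by (simp add: cr_padic_def fun_eq_iff)
  qed
qed

setup_lifting Quotient_padic

instantiation padic :: (prime_card) field
begin

lift_definition zero_padic :: "'a padic" is "\<lambda>_. 0"
  by (simp add: padic_rel_def padic_null_def)

lift_definition one_padic :: "'a padic" is "\<lambda>_. 1"
  by (simp add: padic_rel_def padic_null_def)

lift_definition plus_padic :: "'a padic \<Rightarrow> 'a padic \<Rightarrow> 'a padic" is "\<lambda>X Y n. X n + Y n"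
proof -
  fix X X' Y Y' assume "padic_rel CARD('a) X X'" "padic_rel CARD('a) Y Y'"
  then show "padic_rel CARD('a) (\<lambda>n. X n + Y n) (\<lambda>n. X' n + Y' n)"
    using padic_null_add[OF prime_card, of "\<lambda>n. X n - X' n" "\<lambda>n. Y n - Y' n"]
    by (auto simp: padic_rel_def padic_cauchy_add[OF prime_card] algebra_simps)
qed

lift_definition uminus_padic :: "'a padic \<Rightarrow> 'a padic" is "\<lambda>X n. - X n"
proof -
  fix X X' assume "padic_rel CARD('a) X X'"
  then show "padic_rel CARD('a) (\<lambda>n. - X n) (\<lambda>n. - X' n)"
    using padic_null_minus[OF prime_card, of "\<lambda>n. X n - X' n"]
    by (auto simp: padic_rel_def padic_cauchy_minus[OF prime_card] algebra_simps)
qed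

lift_definition times_padic :: "'a padic \<Rightarrow> 'a padic \<Rightarrow> 'a padic" is "\<lambda>X Y n. X n * Y n"
  by (rule padic_rel_mult[OF prime_card])

lift_definition inverse_padic :: "'a padic \<Rightarrow> 'a padic"
  is "\<lambda>X. if padic_null CARD('a) X then (\<lambda>_. 0) else (\<lambda>n. inverse (X n))"
proof -
  fix X X' assume r: "padic_rel CARD('a) X X'"
  have "padic_rel CARD('a) (\<lambda>_. 0) (\<lambda>_. 0)" by (simp add: padic_rel_def padic_null_def)
  then show "padic_rel CARD('a)
      (if padic_null CARD('a) X then (\<lambda>_. 0) else (\<lambda>n. inverse (X n)))
      (if padic_null CARD('a) X' then (\<lambda>_. 0) else (\<lambda>n. inverse (X' n)))"
    using padic_null_rel[OF prime_card r] padic_rel_inverse[OF prime_card r] by simp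
qed

definition "x - (y :: 'a padic) = x + - y"
definition "x div (y :: 'a padic) = x * inverse y"

lemma padic_relI: "padic_cauchy p X \<Longrightarrow> padic_cauchy p Y \<Longrightarrow> (\<And>n. X n = Y n) \<Longrightarrow> padic_rel p X Y"
  by (simp add: padic_rel_def padic_null_def)

instance
proof
  fix a b c :: "'a padic"
  note cs = padic_cauchy_add[OF prime_card] padic_cauchy_mult[OF prime_card]
    padic_cauchy_minus[OF prime_card] padic_cauchy_const
  have D: "padic_cauchy CARD('a) X" if "padic_rel CARD('a) X X" for X
    using that by (simp add: padic_rel_def)
  show "a + b + c = a + (b + c)"
    by transfer (auto intro!: padic_relI cs dest!: D)
  show "a + b = b + a"
    by transfer (auto intro!: padic_relI cs dest!: D)
  show "0 + a = a"
    by transfer (auto intro!: padic_relI cs dest!: D)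
  show "- a + a = 0"
    by transfer (auto intro!: padic_relI cs dest!: D)
  show "a - b = a + - b" by (rule minus_padic_def)
  show "a * b * c = a * (b * c)"
    by transfer (auto intro!: padic_relI cs dest!: D)
  show "a * b = b * a"
    by transfer (auto intro!: padic_relI cs dest!: D)
  show "1 * a = a"
    by transfer (auto intro!: padic_relI cs dest!: D)
  show "(a + b) * c = a * c + b * c"
    by transfer (auto intro!: padic_relI cs dest!: D simp: algebra_simps)
  show "(0 :: 'a padic) \<noteq> 1"
    by transfer (use LIMSEQ_unique[OF tendsto_const[of "1 :: real"], of 0] in
      \<open>auto simp: padic_rel_def padic_null_def prime_card\<close>)
  show "a div b = a * inverse b" by (rule divide_padic_def)
  show "inverse (0 :: 'a padic) = 0"
    by transfer (auto simp: padic_rel_def padic_null_def)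
  show "inverse a * a = 1" if "a \<noteq> 0"
    using that
  proof transfer
    fix X assume r: "padic_rel CARD('a) X X" and "\<not> padic_rel CARD('a) X (\<lambda>_. 0)"
    then have nn: "\<not> padic_null CARD('a) X" by (simp add: padic_rel_def)
    have c: "padic_cauchy CARD('a) X" by (rule D[OF r])
    have ci: "padic_cauchy CARD('a) (\<lambda>n. inverse (X n))"
      by (rule padic_cauchy_inverse[OF prime_card c nn])
    obtain b M where b: "b > 0" "\<And>n. n \<ge> M \<Longrightarrow> rat_padic_abs CARD('a) (X n) \<ge> b"
      by (rule padic_cauchy_not_null[OF prime_card c nn]) blast
    have "\<forall>\<^sub>F n in sequentially. rat_padic_abs CARD('a) (inverse (X n) * X n - 1) = 0"
    proof (rule eventually_sequentiallyI[of M])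
      fix n assume "n \<ge> M"
      then have "X n \<noteq> 0" using b by fastforce
      then show "rat_padic_abs CARD('a) (inverse (X n) * X n - 1) = 0" by simp
    qed
    then have "padic_null CARD('a) (\<lambda>n. inverse (X n) * X n - 1)"
      unfolding padic_null_def by (rule tendsto_eventually)
    then show "padic_rel CARD('a)
        (\<lambda>n. (if padic_null CARD('a) X then (\<lambda>_. 0) else (\<lambda>n. inverse (X n))) n * X n) (\<lambda>_. 1)"
      using nn c ci by (simp add: padic_rel_def cs)
  qed
qed

end

lift_definition padic_abs :: "'p :: prime_card padic \<Rightarrow> real"
  is "\<lambda>X. lim (\<lambda>n. rat_padic_abs CARD('p) (X n))"
proof -
  fix X Y assume "padic_rel CARD('p) X Y"
  then have n: "(\<lambda>n. rat_padic_abs CARD('p) (X n - Y n)) \<longlonglongrightarrow> 0"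
    by (simp add: padic_rel_def padic_null_def)
  have "(\<lambda>n. rat_padic_abs CARD('p) (X n) - rat_padic_abs CARD('p) (Y n)) \<longlonglongrightarrow> 0"
    by (rule Lim_null_comparison[OF _ n]) (simp add: rat_padic_abs_abs_diff[OF prime_card])
  then have "((\<lambda>n. rat_padic_abs CARD('p) (X n)) \<longlonglongrightarrow> L) \<longleftrightarrow> ((\<lambda>n. rat_padic_abs CARD('p) (Y n)) \<longlonglongrightarrow> L)" for L
    by (rule Lim_transform_eq)
  then show "lim (\<lambda>n. rat_padic_abs CARD('p) (X n)) = lim (\<lambda>n. rat_padic_abs CARD('p) (Y n))"
    by (simp add: lim_def)
qed

text \<open>The structure map of F or E as an extension of the p-adic numbers is part of the data.\<close>

definition finite_padic_extension :: "('p :: prime_card padic \<Rightarrow> 'k :: field) \<Rightarrow> bool"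
  where "finite_padic_extension \<iota> \<longleftrightarrow>
    field_hom \<iota> \<and> (\<exists>B. finite_dimensional_vector_space (\<lambda>c x. \<iota> c * x) B)"

definition nonarch_abs :: "('k :: field \<Rightarrow> real) \<Rightarrow> bool"
  where "nonarch_abs a \<longleftrightarrow>
    (\<forall>x. a x \<ge> 0) \<and> (\<forall>x. a x = 0 \<longleftrightarrow> x = 0) \<and>
    (\<forall>x y. a (x * y) = a x * a y) \<and> (\<forall>x y. a (x + y) \<le> max (a x) (a y))"

definition nontrivial_abs :: "('k :: field \<Rightarrow> real) \<Rightarrow> bool"
  where "nontrivial_abs a \<longleftrightarrow> (\<exists>x. x \<noteq> 0 \<and> a x \<noteq> 1)"

section \<open>Linear algebraic groups\<close>

type_synonym ('v, 'k) mpoly = "('v \<Rightarrow>\<^sub>0 nat) \<Rightarrow>\<^sub>0 'k"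

definition mpoly_eval :: "('k :: zero \<Rightarrow> 'r :: comm_ring_1) \<Rightarrow> ('v, 'k) mpoly \<Rightarrow> ('v \<Rightarrow> 'r) \<Rightarrow> 'r"
  where "mpoly_eval \<phi> f x =
    (\<Sum>m\<in>Poly_Mapping.keys f. \<phi> (Poly_Mapping.lookup f m) *
      (\<Prod>v\<in>Poly_Mapping.keys m. x v ^ Poly_Mapping.lookup m v))"

definition GL :: "('r :: comm_ring_1 ^ 'n ^ 'n) monoid"
  where "GL = \<lparr>carrier = {A. invertible A}, monoid.mult = (**), one = mat 1\<rparr>"

text \<open>A set S of polynomials over k in the matrix entries cuts out a closed subscheme of the
  general linear group over k; these are its points in a k-algebra with structure map \<open>\<phi>\<close>.\<close>

definition alg_points :: "('k :: field \<Rightarrow> 'r :: comm_ring_1) \<Rightarrow> ('n \<times> 'n, 'k) mpoly set \<Rightarrow> ('r ^ 'n ^ 'n) set"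
  where "alg_points \<phi> S =
    {A. invertible A \<and> (\<forall>f\<in>S. mpoly_eval \<phi> f (\<lambda>(i, j). A $ i $ j) = 0)}"

text \<open>Only used in characteristic 0, where a linear algebraic group over k is the same as a
  subgroup of the general linear group over an algebraic closure that is the zero locus of
  polynomials with coefficients in k.\<close>

definition linear_algebraic_group :: "('n :: finite \<times> 'n, 'k :: field) mpoly set \<Rightarrow> bool"
  where "linear_algebraic_group S \<longleftrightarrow>
    subgroup (alg_points to_ac S :: ('k alg_closure ^ 'n ^ 'n) set) GL"

definition zariski_closed :: "('k :: field ^ 'n ^ 'n) set \<Rightarrow> bool"
  where "zariski_closed H \<longleftrightarrow> (\<exists>T. H = alg_points (\<lambda>x. x) T)"

text \<open>For closed subsets H of the general linear group only.\<close>

definition zariski_connected :: "('k :: field ^ 'n ^ 'n) set \<Rightarrow> bool"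
  where "zariski_connected H \<longleftrightarrow>
    \<not> (\<exists>A B. zariski_closed A \<and> zariski_closed B \<and> A \<noteq> {} \<and> B \<noteq> {} \<and> A \<inter> B = {} \<and> A \<union> B = H)"

definition unipotent :: "'k :: field ^ 'n ^ 'n \<Rightarrow> bool"
  where "unipotent A \<longleftrightarrow> (\<exists>N. (((**) (A - mat 1)) ^^ N) (mat 1) = 0)"

text \<open>Reductive means trivial unipotent radical over an algebraic closure. Connectedness is
  not required.\<close>

definition reductive_group :: "('n :: finite \<times> 'n, 'k :: field) mpoly set \<Rightarrow> bool"
  where "reductive_group S \<longleftrightarrow> linear_algebraic_group S \<and>
    (\<forall>U :: ('k alg_closure ^ 'n ^ 'n) set.
      U \<lhd> GL\<lparr>carrier := alg_points to_ac S\<rparr> \<and> zariski_closed U \<and> zariski_connected U \<and>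
      (\<forall>u\<in>U. unipotent u) \<longrightarrow> U = {mat 1})"

definition rational_points :: "('n :: finite \<times> 'n, 'k :: field) mpoly set \<Rightarrow> ('k ^ 'n ^ 'n) monoid"
  where "rational_points S = GL\<lparr>carrier := alg_points (\<lambda>x. x) S\<rparr>"

section \<open>Smooth admissible representations\<close>

definition matrix_topology :: "('k :: field \<Rightarrow> real) \<Rightarrow> ('k ^ 'n :: finite ^ 'n) set \<Rightarrow> ('k ^ 'n ^ 'n) topology"
  where "matrix_topology a H =
    Metric_space.mtopology H (\<lambda>A B. Max (range (\<lambda>(i, j). a (A $ i $ j - B $ i $ j))))"

definition linear_representation ::
    "('g, 'x) monoid_scheme \<Rightarrow> ('e :: field \<Rightarrow> 'v :: ab_group_add \<Rightarrow> 'v) \<Rightarrow> ('g \<Rightarrow> 'v \<Rightarrow> 'v) \<Rightarrow> bool"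
  where "linear_representation G s \<pi> \<longleftrightarrow>
    vector_space s \<and> (\<forall>g\<in>carrier G. Vector_Spaces.linear s s (\<pi> g)) \<and>
    (\<forall>v. \<pi> \<one>\<^bsub>G\<^esub> v = v) \<and>
    (\<forall>g\<in>carrier G. \<forall>h\<in>carrier G. \<forall>v. \<pi> (g \<otimes>\<^bsub>G\<^esub> h) v = \<pi> g (\<pi> h v))"

definition smooth :: "'g topology \<Rightarrow> ('g, 'x) monoid_scheme \<Rightarrow> ('g \<Rightarrow> 'v \<Rightarrow> 'v) \<Rightarrow> bool"
  where "smooth T G \<pi> \<longleftrightarrow> (\<forall>v. openin T {g \<in> carrier G. \<pi> g v = v})"

definition admissible ::
    "'g topology \<Rightarrow> ('g, 'x) monoid_scheme \<Rightarrow> ('e :: field \<Rightarrow> 'v :: ab_group_add \<Rightarrow> 'v) \<Rightarrow> ('g \<Rightarrow> 'v \<Rightarrow> 'v) \<Rightarrow> bool"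
  where "admissible T G s \<pi> \<longleftrightarrow>
    (\<forall>K. subgroup K G \<and> openin T K \<and> compactin T K \<longrightarrow>
      (\<exists>W. finite W \<and> {v. \<forall>k\<in>K. \<pi> k v = v} = module.span s W))"

section \<open>Weil restriction and algebraic representations\<close>

text \<open>Let B be a basis of F over the p-adic numbers. For an algebra R over the p-adic numbers
  with structure map j, a matrix over the tensor product of R and F is written as a family of
  matrices Y b over R, for b in B (and 0 outside B), standing for the sum of the
  \<open>Y b \<otimes> b\<close>; products are computed with the structure constants of F.\<close>

definition coord :: "('q :: field \<Rightarrow> 'f :: field) \<Rightarrow> 'f set \<Rightarrow> 'f \<Rightarrow> 'f \<Rightarrow> 'q"
  where "coord \<iota> B x b = module.representation (\<lambda>c y. \<iota> c * y) B x b"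

definition res_matrices ::
    "('q :: field \<Rightarrow> 'f :: field) \<Rightarrow> 'f set \<Rightarrow> ('q \<Rightarrow> 'r :: comm_ring_1) \<Rightarrow> ('f \<Rightarrow> 'r ^ 'n ^ 'n) monoid"
  where "res_matrices \<iota> B j =
    \<lparr>carrier = {Y. \<forall>b. b \<notin> B \<longrightarrow> Y b = 0},
     monoid.mult = (\<lambda>Y Z c. \<Sum>a\<in>B. \<Sum>b\<in>B. mat (j (coord \<iota> B (a * b) c)) ** (Y a ** Z b)),
     one = (\<lambda>c. mat (j (coord \<iota> B 1 c)))\<rparr>"

text \<open>Substitute the sum of the \<open>b * y (b, i, k)\<close> for the variable at (i, k) in f and expand the
  result along B: this is the coefficient at b, a polynomial over the p-adic numbers.\<close>

definition res_equation ::
    "('q :: field \<Rightarrow> 'f :: field) \<Rightarrow> 'f set \<Rightarrow> ('n \<times> 'n, 'f) mpoly \<Rightarrow> 'f \<Rightarrow> ('f \<times> 'n \<times> 'n, 'q) mpoly"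
  where "res_equation \<iota> B f b =
    Poly_Mapping.map (\<lambda>x. coord \<iota> B x b)
      (mpoly_eval (Poly_Mapping.single 0) f
        (\<lambda>(i, k). \<Sum>a\<in>B. Poly_Mapping.single (Poly_Mapping.single (a, i, k) 1) a))"

definition weil_restriction_points ::
    "('q :: field \<Rightarrow> 'f :: field) \<Rightarrow> 'f set \<Rightarrow> ('n :: finite \<times> 'n, 'f) mpoly set \<Rightarrow>
     ('q \<Rightarrow> 'r :: comm_ring_1) \<Rightarrow> ('f \<Rightarrow> 'r ^ 'n ^ 'n) set"
  where "weil_restriction_points \<iota> B S j =
    {Y \<in> Units (res_matrices \<iota> B j).
      \<forall>f\<in>S. \<forall>b\<in>B. mpoly_eval j (res_equation \<iota> B f b) (\<lambda>(a, i, k). Y a $ i $ k) = 0}"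

text \<open>A regular function on the Weil restriction: a polynomial in the coordinates of Y and of
  its inverse.\<close>

definition res_eval ::
    "('q :: field \<Rightarrow> 'f :: field) \<Rightarrow> 'f set \<Rightarrow> ('q \<Rightarrow> 'r :: comm_ring_1) \<Rightarrow> ('e :: field \<Rightarrow> 'r) \<Rightarrow>
     (('f \<times> 'n \<times> 'n) + ('f \<times> 'n \<times> 'n), 'e) mpoly \<Rightarrow> ('f \<Rightarrow> 'r ^ 'n :: finite ^ 'n) \<Rightarrow> 'r"
  where "res_eval \<iota> B j \<phi> P Y =
    mpoly_eval \<phi> P
      (case_sum (\<lambda>(a, i, k). Y a $ i $ k)
                (\<lambda>(a, i, k). (inv\<^bsub>res_matrices \<iota> B j\<^esub> Y) a $ i $ k))"

definition res_point ::
    "('q :: field \<Rightarrow> 'f :: field) \<Rightarrow> 'f set \<Rightarrow> ('q \<Rightarrow> 'r :: comm_ring_1) \<Rightarrow> 'f ^ 'n ^ 'n \<Rightarrow> 'f \<Rightarrow> 'r ^ 'n ^ 'n"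
  where "res_point \<iota> B j A = (\<lambda>b. \<chi> i k. j (coord \<iota> B (A $ i $ k) b))"

text \<open>The action of the group of F-points comes from a homomorphism of algebraic groups over E
  from the base change to E of the Weil restriction to the automorphisms of the representation
  space: regular functions P c d over E (the matrix coefficients with respect to a basis C) that
  are multiplicative and unital on points over an algebraic closure of E. The choice of B and C
  does not matter.\<close>

definition algebraic_representation ::
    "('q :: field \<Rightarrow> 'f :: field) \<Rightarrow> ('q \<Rightarrow> 'e :: field) \<Rightarrow> ('n :: finite \<times> 'n, 'f) mpoly set \<Rightarrow>
     ('e \<Rightarrow> 'w :: ab_group_add \<Rightarrow> 'w) \<Rightarrow> ('f ^ 'n ^ 'n \<Rightarrow> 'w \<Rightarrow> 'w) \<Rightarrow> bool"
  where "algebraic_representation \<iota>F \<iota>E S s \<sigma> \<longleftrightarrow>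
    linear_representation (rational_points S) s \<sigma> \<and>
    (\<exists>B C P. finite_dimensional_vector_space (\<lambda>c x. \<iota>F c * x) B \<and>
      finite_dimensional_vector_space s C \<and>
      (let j = (\<lambda>x. to_ac (\<iota>E x));
           R = res_matrices \<iota>F B j;
           H = weil_restriction_points \<iota>F B S j;
           \<rho> = (\<lambda>Y c d. res_eval \<iota>F B j to_ac (P c d) Y)
       in (\<forall>c\<in>C. \<forall>d\<in>C. \<rho> \<one>\<^bsub>R\<^esub> c d = (if c = d then 1 else 0)) \<and>
          (\<forall>Y\<in>H. \<forall>Z\<in>H. \<forall>c\<in>C. \<forall>d\<in>C.
             \<rho> (Y \<otimes>\<^bsub>R\<^esub> Z) c d = (\<Sum>e\<in>C. \<rho> Y c e * \<rho> Z e d))) \<and>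
      (\<forall>g\<in>carrier (rational_points S). \<forall>d\<in>C.
         \<sigma> g d = (\<Sum>c\<in>C. s (res_eval \<iota>F B \<iota>E (\<lambda>x. x) (P c d) (res_point \<iota>F B \<iota>E g)) c)))"

section \<open>Tensor products\<close>

text \<open>V together with the map \<open>t\<close> is a tensor product of A and B: the linear map from the free
  vector space on the pairs (a, b) to V given by \<open>t\<close> is onto, and its kernel is spanned by the
  bilinearity relators.\<close>

definition tensor_relators ::
    "('e :: field \<Rightarrow> 'a :: ab_group_add \<Rightarrow> 'a) \<Rightarrow> ('e \<Rightarrow> 'b :: ab_group_add \<Rightarrow> 'b) \<Rightarrow> (('a \<times> 'b) \<Rightarrow>\<^sub>0 'e) set"
  where "tensor_relators sA sB =
    (let e = (\<lambda>a b. Poly_Mapping.single (a, b) 1) in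
      {e (a + a') b - e a b - e a' b | a a' b. True} \<union>
      {e a (b + b') - e a b - e a b' | a b b'. True} \<union>
      {e (sA c a) b - Poly_Mapping.single (a, b) c | a b c. True} \<union>
      {e a (sB c b) - Poly_Mapping.single (a, b) c | a b c. True})"

definition is_tensor_product ::
    "('e :: field \<Rightarrow> 'a :: ab_group_add \<Rightarrow> 'a) \<Rightarrow> ('e \<Rightarrow> 'b :: ab_group_add \<Rightarrow> 'b) \<Rightarrow>
     ('e \<Rightarrow> 'v :: ab_group_add \<Rightarrow> 'v) \<Rightarrow> ('a \<Rightarrow> 'b \<Rightarrow> 'v) \<Rightarrow> bool"
  where "is_tensor_product sA sB sV t \<longleftrightarrow> vector_space sV \<and>
    (let h = (\<lambda>x. \<Sum>(a, b)\<in>Poly_Mapping.keys x. sV (Poly_Mapping.lookup x (a, b)) (t a b)) in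
      range h = UNIV \<and>
      {x. h x = 0} = module.span (\<lambda>c. Poly_Mapping.map ((*) c)) (tensor_relators sA sB))"

text \<open>The condition determines \<open>\<rho>\<close>, because the \<open>t a b\<close> span V.\<close>

definition diagonal_action ::
    "('g, 'x) monoid_scheme \<Rightarrow> ('e :: field \<Rightarrow> 'v :: ab_group_add \<Rightarrow> 'v) \<Rightarrow> ('a \<Rightarrow> 'b \<Rightarrow> 'v) \<Rightarrow>
     ('g \<Rightarrow> 'a \<Rightarrow> 'a) \<Rightarrow> ('g \<Rightarrow> 'b \<Rightarrow> 'b) \<Rightarrow> ('g \<Rightarrow> 'v \<Rightarrow> 'v) \<Rightarrow> bool"
  where "diagonal_action G s t \<pi> \<sigma> \<rho> \<longleftrightarrow>
    (\<forall>g\<in>carrier G. Vector_Spaces.linear s s (\<rho> g) \<and> (\<forall>a b. \<rho> g (t a b) = t (\<pi> g a) (\<sigma> g b)))"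

section \<open>Norms\<close>

definition is_norm :: "('e :: field \<Rightarrow> real) \<Rightarrow> ('e \<Rightarrow> 'v :: ab_group_add \<Rightarrow> 'v) \<Rightarrow> ('v \<Rightarrow> real) \<Rightarrow> bool"
  where "is_norm a s \<alpha> \<longleftrightarrow>
    (\<forall>v. \<alpha> v \<ge> 0) \<and> (\<forall>c v. \<alpha> (s c v) = a c * \<alpha> v) \<and>
    (\<forall>v w. \<alpha> (v + w) \<le> max (\<alpha> v) (\<alpha> w)) \<and> (\<forall>v. \<alpha> v = 0 \<longrightarrow> v = 0)"

definition dist_inf :: "('v :: zero \<Rightarrow> real) \<Rightarrow> ('v \<Rightarrow> real) \<Rightarrow> ennreal"
  where "dist_inf \<alpha> \<beta> = (SUP v\<in>UNIV - {0}. ennreal \<bar>ln (\<alpha> v / \<beta> v)\<bar>)"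

definition finite_distance_component ::
    "('e :: field \<Rightarrow> real) \<Rightarrow> ('e \<Rightarrow> 'v :: ab_group_add \<Rightarrow> 'v) \<Rightarrow> ('v \<Rightarrow> real) \<Rightarrow> ('v \<Rightarrow> real) set"
  where "finite_distance_component a s \<alpha>0 = {\<alpha>. is_norm a s \<alpha> \<and> dist_inf \<alpha> \<alpha>0 < \<infinity>}"

definition norm_action ::
    "('g, 'x) monoid_scheme \<Rightarrow> ('g \<Rightarrow> 'v \<Rightarrow> 'v) \<Rightarrow> 'g \<Rightarrow> ('v \<Rightarrow> real) \<Rightarrow> 'v \<Rightarrow> real"
  where "norm_action G \<rho> g \<alpha> = (\<lambda>v. \<alpha> (\<rho> (inv\<^bsub>G\<^esub> g) v))"

end

theory Submission
  imports Defs
begin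

text \<open>
  If \<open>\<alpha>\<close> is an invariant norm at distance at most C from \<open>\<alpha>0\<close>, then every translate of \<open>\<alpha>0\<close>
  is at distance at most C from \<open>\<alpha>\<close> as well, because translation is an isometry; hence the orbit
  of \<open>\<alpha>0\<close> has diameter at most 2C. Conversely, the ultrametric inequality is stable under
  suprema, so if the orbit is bounded, the pointwise supremum of all translates of \<open>\<alpha>0\<close> is
  finite, is again a norm, stays within the bound of the orbit from \<open>\<alpha>0\<close>, and is invariant
  because translation permutes the orbit. This is \<open>bounded_orbit_imp_invariant_norm\<close>.

  Both directions need a genuine group action on V: inverses must exist and the operators
  \<open>\<rho> g\<close> must compose. The first is \<open>rational_points_group\<close>: by hypothesis the points over the
  algebraic closure form a group, and the rational points are the preimage of that group
  under the inclusion of the base field. The second is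
  \<open>diagonal_action_linear_representation\<close>: the pure tensors span V, and on them \<open>\<rho>\<close> is given by
  the two representations.
\<close>

section \<open>The group of rational points\<close>

lemma group_GL: "group (GL :: ('r :: comm_ring_1 ^ 'n :: finite ^ 'n) monoid)"
proof (rule groupI)
  fix A B C :: "'r ^ 'n ^ 'n"
  assume A: "A \<in> carrier GL"
  then obtain A' where A': "A ** A' = mat 1" "A' ** A = mat 1"
    by (auto simp: GL_def invertible_def)
  then show "\<exists>B\<in>carrier GL. B \<otimes>\<^bsub>GL\<^esub> A = \<one>\<^bsub>GL\<^esub>"
    by (auto simp: GL_def invertible_def)
  show "A \<otimes>\<^bsub>GL\<^esub> B \<in> carrier GL" if "B \<in> carrier GL"
    using A that by (simp add: GL_def invertible_mult)
  show "A \<otimes>\<^bsub>GL\<^esub> B \<otimes>\<^bsub>GL\<^esub> C = A \<otimes>\<^bsub>GL\<^esub> (B \<otimes>\<^bsub>GL\<^esub> C)"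
    by (simp add: GL_def matrix_mul_assoc)
  show "\<one>\<^bsub>GL\<^esub> \<otimes>\<^bsub>GL\<^esub> A = A"
    by (simp add: GL_def)
next
  show "\<one>\<^bsub>GL\<^esub> \<in> carrier (GL :: ('r ^ 'n ^ 'n) monoid)"
    by (auto simp: GL_def invertible_def intro!: exI[of _ "mat 1"])
qed

definition ac_matrix :: "'k :: field ^ 'n ^ 'n \<Rightarrow> 'k alg_closure ^ 'n ^ 'n"
  where "ac_matrix A = (\<chi> i j. to_ac (A $ i $ j))"

lemma ac_matrix_mult: "ac_matrix (A ** B) = ac_matrix A ** ac_matrix B"
  by (simp add: ac_matrix_def matrix_matrix_mult_def to_ac_sum)

lemma ac_matrix_one: "ac_matrix (mat 1) = mat 1"
  by (auto simp: ac_matrix_def mat_def vec_eq_iff)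

lemma ac_matrix_hom: "group_hom GL GL (ac_matrix :: 'k :: field ^ 'n :: finite ^ 'n \<Rightarrow> _)"
proof (intro group_hom.intro group_GL group_hom_axioms.intro homI)
  fix A B :: "'k ^ 'n ^ 'n"
  show "ac_matrix (A \<otimes>\<^bsub>GL\<^esub> B) = ac_matrix A \<otimes>\<^bsub>GL\<^esub> ac_matrix B"
    by (simp add: GL_def ac_matrix_mult)
  assume "A \<in> carrier GL"
  then obtain A' where "A ** A' = mat 1" "A' ** A = mat 1"
    by (auto simp: GL_def invertible_def)
  then have "ac_matrix A ** ac_matrix A' = mat 1" "ac_matrix A' ** ac_matrix A = mat 1"
    by (simp_all add: ac_matrix_one flip: ac_matrix_mult)
  then show "ac_matrix A \<in> carrier GL"
    by (auto simp: GL_def invertible_def)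
qed

lemma mpoly_eval_to_ac: "mpoly_eval to_ac f (\<lambda>v. to_ac (x v)) = to_ac (mpoly_eval (\<lambda>c. c) f x)"
  by (simp add: mpoly_eval_def to_ac_sum to_ac_prod)

text \<open>The equations have coefficients in the base field, so they hold for a matrix exactly when
  they hold for its image over the closure: the embedding of fields is injective.\<close>

lemma rational_points_preimage:
  fixes S :: "('n :: finite \<times> 'n, 'k :: field) mpoly set"
  shows "alg_points (\<lambda>c. c) S = {A \<in> carrier GL. ac_matrix A \<in> alg_points to_ac S}"
proof -
  have "mpoly_eval to_ac f (\<lambda>(i, j). ac_matrix A $ i $ j) =
      to_ac (mpoly_eval (\<lambda>c. c) f (\<lambda>(i, j). A $ i $ j))" for f :: "('n \<times> 'n, 'k) mpoly" and A
    by (simp add: ac_matrix_def flip: mpoly_eval_to_ac) (simp add: case_prod_unfold)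
  moreover have "invertible (ac_matrix A)" if "invertible A" for A :: "'k ^ 'n ^ 'n"
    using group_hom.hom_closed[OF ac_matrix_hom, of A] that by (simp add: GL_def)
  ultimately show ?thesis
    by (auto simp: alg_points_def GL_def)
qed

lemma (in group_hom) subgroup_preimage:
  assumes "subgroup K H"
  shows "subgroup {x \<in> carrier G. h x \<in> K} G"
proof -
  interpret K: subgroup K H by fact
  show ?thesis by (rule G.subgroupI) auto
qed

lemma rational_points_group:
  assumes "linear_algebraic_group S"
  shows "group (rational_points S)"
  unfolding rational_points_def rational_points_preimage
  using assms unfolding linear_algebraic_group_def
  by (intro subgroup.subgroup_is_group group_hom.subgroup_preimage[OF ac_matrix_hom] group_GL)

section \<open>The diagonal representation\<close>

text \<open>The universal map from the free vector space on pairs is onto, so every vector is a finite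
  combination of pure tensors.\<close>

lemma is_tensor_product_eqI:
  assumes "is_tensor_product sA sB sV t"
    and f: "Vector_Spaces.linear sV sV f" and g: "Vector_Spaces.linear sV sV g"
    and eq: "\<And>a b. f (t a b) = g (t a b)"
  shows "f = g"
proof
  fix v
  obtain x where v: "v = (\<Sum>(a, b)\<in>Poly_Mapping.keys x. sV (Poly_Mapping.lookup x (a, b)) (t a b))"
    using assms(1) unfolding is_tensor_product_def Let_def by (metis (no_types, lifting) UNIV_I imageE)
  interpret f: Vector_Spaces.linear sV sV f by fact
  interpret g: Vector_Spaces.linear sV sV g by fact
  show "f v = g v"
    unfolding v by (simp add: f.sum g.sum case_prod_unfold f.scale g.scale eq)
qed

lemma diagonal_action_linear_representation:
  assumes G: "group G"
    and \<pi>: "linear_representation G sA \<pi>" and \<sigma>: "linear_representation G sB \<sigma>"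
    and t: "is_tensor_product sA sB sV t" and \<rho>: "diagonal_action G sV t \<pi> \<sigma> \<rho>"
  shows "linear_representation G sV \<rho>"
proof -
  interpret group G by fact
  have V: "vector_space sV" using t by (simp add: is_tensor_product_def)
  have lin: "Vector_Spaces.linear sV sV (\<rho> g)" if "g \<in> carrier G" for g
    using \<rho> that by (simp add: diagonal_action_def)
  have pure: "\<rho> g (t a b) = t (\<pi> g a) (\<sigma> g b)" if "g \<in> carrier G" for g a b
    using \<rho> that by (simp add: diagonal_action_def)
  have "\<rho> \<one>\<^bsub>G\<^esub> = id"
    by (rule is_tensor_product_eqI[OF t lin vector_space.linear_id[OF V]])
       (use \<pi> \<sigma> in \<open>simp_all add: pure linear_representation_def\<close>)
  moreover have "\<rho> (g \<otimes>\<^bsub>G\<^esub> h) = \<rho> g \<circ> \<rho> h" if "g \<in> carrier G" "h \<in> carrier G" for g h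
    by (rule is_tensor_product_eqI[OF t lin Vector_Spaces.linear_compose[OF lin lin]])
       (use \<pi> \<sigma> that in \<open>simp_all add: pure linear_representation_def\<close>)
  ultimately show ?thesis
    using V lin by (simp add: linear_representation_def)
qed

section \<open>Norms at finite distance\<close>

lemma is_norm_pos: "is_norm a s \<alpha> \<Longrightarrow> v \<noteq> 0 \<Longrightarrow> 0 < \<alpha> v"
  unfolding is_norm_def by (metis order_le_less)

lemma is_norm_zero:
  assumes "nonarch_abs a" "vector_space s" "is_norm a s \<alpha>"
  shows "\<alpha> 0 = 0"
proof -
  interpret vector_space s by fact
  have "\<alpha> (s 0 0) = a 0 * \<alpha> 0" using assms(3) unfolding is_norm_def by blast
  moreover have "a 0 = 0" using assms(1) unfolding nonarch_abs_def by blast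
  ultimately show ?thesis by simp
qed

lemma abs_ln_divide_le_iff:
  fixes x y C :: real
  assumes "0 < x" "0 < y"
  shows "\<bar>ln (x / y)\<bar> \<le> C \<longleftrightarrow> x \<le> exp C * y \<and> y \<le> exp C * x"
proof -
  have ln_le: "ln z \<le> C \<longleftrightarrow> z \<le> exp C" if "0 < z" for z :: real
    using exp_le_cancel_iff[of "ln z" C] that by simp
  have "ln (x / y) \<le> C \<longleftrightarrow> x \<le> exp C * y"
    using assms by (simp add: ln_le divide_le_eq)
  moreover have "ln (y / x) \<le> C \<longleftrightarrow> y \<le> exp C * x"
    using assms by (simp add: ln_le divide_le_eq)
  moreover have "ln (y / x) = - ln (x / y)" using assms by (simp add: ln_div)
  ultimately show ?thesis by linarith
qed

text \<open>Multiplicative bounds replace the logarithms from here on. The values at 0 are required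
  only so that the bounds can range over all vectors, while the supremum skips 0.\<close>

lemma dist_inf_le_iff:
  assumes "0 \<le> C" "\<And>v. v \<noteq> 0 \<Longrightarrow> 0 < \<alpha> v" "\<And>v. v \<noteq> 0 \<Longrightarrow> 0 < \<beta> v" "\<alpha> 0 = 0" "\<beta> 0 = 0"
  shows "dist_inf \<alpha> \<beta> \<le> ennreal C \<longleftrightarrow> (\<forall>v. \<alpha> v \<le> exp C * \<beta> v \<and> \<beta> v \<le> exp C * \<alpha> v)"
proof -
  have "dist_inf \<alpha> \<beta> \<le> ennreal C \<longleftrightarrow> (\<forall>v. v \<noteq> 0 \<longrightarrow> \<bar>ln (\<alpha> v / \<beta> v)\<bar> \<le> C)"
    using assms(1) by (auto simp: dist_inf_def SUP_le_iff)
  also have "\<dots> \<longleftrightarrow> (\<forall>v. v \<noteq> 0 \<longrightarrow> \<alpha> v \<le> exp C * \<beta> v \<and> \<beta> v \<le> exp C * \<alpha> v)"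
    using assms(2,3) by (simp add: abs_ln_divide_le_iff)
  also have "\<dots> \<longleftrightarrow> (\<forall>v. \<alpha> v \<le> exp C * \<beta> v \<and> \<beta> v \<le> exp C * \<alpha> v)"
    using assms(4,5) by (metis mult_zero_right order_refl)
  finally show ?thesis .
qed

lemma ennreal_finite_iff: "x < (\<infinity> :: ennreal) \<longleftrightarrow> (\<exists>C\<ge>0. x \<le> ennreal C)"
  by (cases x) (auto simp: top_unique le_less_trans[OF _ ennreal_less_top])

section \<open>Invariant norms and bounded orbits\<close>

lemma linear_representation_inverse:
  assumes "group G" "linear_representation G s \<rho>" "g \<in> carrier G"
  shows "\<rho> (inv\<^bsub>G\<^esub> g) (\<rho> g v) = v"
  using assms group.inv_closed group.l_inv
  unfolding linear_representation_def by metis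

text \<open>Definiteness survives because \<open>\<rho> g\<close> is invertible.\<close>

lemma is_norm_pullback:
  assumes G: "group G" and \<rho>: "linear_representation G s \<rho>" and \<alpha>: "is_norm a s \<alpha>"
    and g: "g \<in> carrier G"
  shows "is_norm a s (\<lambda>v. \<alpha> (\<rho> g v))"
proof -
  interpret l: Vector_Spaces.linear s s "\<rho> g" using \<rho> g by (simp add: linear_representation_def)
  interpret i: Vector_Spaces.linear s s "\<rho> (inv\<^bsub>G\<^esub> g)"
    using \<rho> g group.inv_closed[OF G] by (simp add: linear_representation_def)
  have "v = 0" if "\<rho> g v = 0" for v
    using linear_representation_inverse[OF G \<rho> g, of v] that by (simp add: i.zero)
  then show ?thesis using \<alpha> by (auto simp: is_norm_def l.add l.scale)
qed

text \<open>The action on norms involves inverses; since \<open>g\<close> runs over the whole group, they can be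
  dropped from the bound.\<close>

lemma bounded_orbit_iff:
  assumes G: "group G" and \<rho>: "linear_representation G s \<rho>"
    and a: "nonarch_abs a" and \<alpha>0: "is_norm a s \<alpha>0"
  shows "(SUP g\<in>carrier G. dist_inf \<alpha>0 (norm_action G \<rho> g \<alpha>0)) < \<infinity> \<longleftrightarrow>
    (\<exists>C\<ge>0. \<forall>g\<in>carrier G. \<forall>v. \<alpha>0 v \<le> exp C * \<alpha>0 (\<rho> g v) \<and> \<alpha>0 (\<rho> g v) \<le> exp C * \<alpha>0 v)"
proof -
  interpret group G by fact
  have V: "vector_space s" using \<rho> by (simp add: linear_representation_def)
  have "dist_inf \<alpha>0 (norm_action G \<rho> g \<alpha>0) \<le> ennreal C \<longleftrightarrow>
      (\<forall>v. \<alpha>0 v \<le> exp C * \<alpha>0 (\<rho> (inv\<^bsub>G\<^esub> g) v) \<and> \<alpha>0 (\<rho> (inv\<^bsub>G\<^esub> g) v) \<le> exp C * \<alpha>0 v)"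
    if "g \<in> carrier G" "0 \<le> C" for g C
    unfolding norm_action_def
    using is_norm_pullback[OF G \<rho> \<alpha>0 inv_closed[OF that(1)]] that \<alpha>0
    by (intro dist_inf_le_iff is_norm_pos is_norm_zero[OF a V]) auto
  then show ?thesis
    unfolding ennreal_finite_iff SUP_le_iff by (metis inv_closed inv_inv)
qed

text \<open>Comparing \<open>\<alpha>0\<close> with its translate through the invariant norm costs the distance twice.\<close>

lemma invariant_norm_imp_bounded_orbit:
  assumes G: "group G" and \<rho>: "linear_representation G s \<rho>"
    and a: "nonarch_abs a" and \<alpha>0: "is_norm a s \<alpha>0"
    and \<alpha>: "\<alpha> \<in> finite_distance_component a s \<alpha>0"
    and inv: "\<forall>g\<in>carrier G. norm_action G \<rho> g \<alpha> = \<alpha>"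
  shows "(SUP g\<in>carrier G. dist_inf \<alpha>0 (norm_action G \<rho> g \<alpha>0)) < \<infinity>"
proof -
  have V: "vector_space s" using \<rho> by (simp add: linear_representation_def)
  obtain C where C: "0 \<le> C" "dist_inf \<alpha> \<alpha>0 \<le> ennreal C" and n: "is_norm a s \<alpha>"
    using \<alpha> unfolding finite_distance_component_def ennreal_finite_iff by blast
  have le: "\<alpha> v \<le> exp C * \<alpha>0 v" "\<alpha>0 v \<le> exp C * \<alpha> v" for v
    using C dist_inf_le_iff[of C \<alpha> \<alpha>0] is_norm_pos[OF n] is_norm_pos[OF \<alpha>0]
      is_norm_zero[OF a V n] is_norm_zero[OF a V \<alpha>0] by blast+
  have inv': "\<alpha> (\<rho> g v) = \<alpha> v" if "g \<in> carrier G" for g v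
    using inv that G group.inv_closed group.inv_inv unfolding norm_action_def by metis
  have "\<alpha>0 v \<le> exp (C + C) * \<alpha>0 w" if "\<alpha> v = \<alpha> w" for v w
  proof -
    have "\<alpha>0 v \<le> exp C * \<alpha> w" using le(2)[of v] that by simp
    also have "\<dots> \<le> exp C * (exp C * \<alpha>0 w)" using le(1) by (intro mult_left_mono) auto
    finally show ?thesis by (simp only: exp_add mult.assoc)
  qed
  then show ?thesis
    unfolding bounded_orbit_iff[OF G \<rho> a \<alpha>0]
    using C(1) inv' by (intro exI[of _ "C + C"]) auto
qed

definition sup_norm :: "('g, 'x) monoid_scheme \<Rightarrow> ('g \<Rightarrow> 'v \<Rightarrow> 'v) \<Rightarrow> ('v \<Rightarrow> real) \<Rightarrow> 'v \<Rightarrow> real"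
  where "sup_norm G \<rho> \<alpha> v = (SUP g\<in>carrier G. \<alpha> (\<rho> g v))"

text \<open>A bound on the orbit makes the supremum finite and keeps it close to \<open>\<alpha>0\<close>. The supremum
  commutes with scaling, preserves the ultrametric inequality, and is definite because
  the identity contributes \<open>\<alpha>0\<close> itself. Replacing v by \<open>\<rho> h v\<close> only reindexes the family.\<close>

lemma bounded_orbit_imp_invariant_norm:
  assumes G: "group G" and \<rho>: "linear_representation G s \<rho>"
    and a: "nonarch_abs a" and \<alpha>0: "is_norm a s \<alpha>0"
    and bdd: "(SUP g\<in>carrier G. dist_inf \<alpha>0 (norm_action G \<rho> g \<alpha>0)) < \<infinity>"
  shows "sup_norm G \<rho> \<alpha>0 \<in> finite_distance_component a s \<alpha>0"
    and "\<forall>g\<in>carrier G. norm_action G \<rho> g (sup_norm G \<rho> \<alpha>0) = sup_norm G \<rho> \<alpha>0"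
proof -
  interpret group G by fact
  have V: "vector_space s" using \<rho> by (simp add: linear_representation_def)
  obtain C where C: "0 \<le> C"
    and up: "\<And>g v. g \<in> carrier G \<Longrightarrow> \<alpha>0 (\<rho> g v) \<le> exp C * \<alpha>0 v"
    using bdd unfolding bounded_orbit_iff[OF G \<rho> a \<alpha>0] by blast
  have ne: "carrier G \<noteq> {}" by auto
  define \<alpha> where "\<alpha> = sup_norm G \<rho> \<alpha>0"
  have ub: "\<alpha>0 (\<rho> g v) \<le> \<alpha> v" if "g \<in> carrier G" for g v
    unfolding \<alpha>_def sup_norm_def using that up by (intro cSUP_upper bdd_aboveI2) auto
  have lub: "\<alpha> v \<le> M" if "\<And>g. g \<in> carrier G \<Longrightarrow> \<alpha>0 (\<rho> g v) \<le> M" for v M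
    unfolding \<alpha>_def sup_norm_def using that by (intro cSUP_least ne)
  have lo: "\<alpha>0 v \<le> \<alpha> v" for v
    using ub[OF one_closed, of v] \<rho> by (simp add: linear_representation_def)
  have pull: "is_norm a s (\<lambda>v. \<alpha>0 (\<rho> g v))" if "g \<in> carrier G" for g
    using is_norm_pullback[OF G \<rho> \<alpha>0 that] .
  have nonneg: "0 \<le> \<alpha> v" for v
    using lo[of v] \<alpha>0 unfolding is_norm_def by (meson order_trans)
  have scale_le: "\<alpha> (s c v) \<le> a c * \<alpha> v" for c v
  proof (rule lub)
    fix g assume g: "g \<in> carrier G"
    have "\<alpha>0 (\<rho> g (s c v)) = a c * \<alpha>0 (\<rho> g v)" using pull[OF g] by (simp add: is_norm_def)
    also have "\<dots> \<le> a c * \<alpha> v"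
      using a ub[OF g] by (intro mult_left_mono) (auto simp: nonarch_abs_def)
    finally show "\<alpha>0 (\<rho> g (s c v)) \<le> a c * \<alpha> v" .
  qed
  have scale: "\<alpha> (s c v) = a c * \<alpha> v" for c v
  proof (rule antisym[OF scale_le])
    interpret vector_space s by fact
    show "a c * \<alpha> v \<le> \<alpha> (s c v)"
    proof (cases "c = 0")
      case True
      moreover have "a 0 = 0" using a unfolding nonarch_abs_def by blast
      ultimately show ?thesis using nonneg by simp
    next
      case False
      have "a c * \<alpha>0 (\<rho> g v) \<le> \<alpha> (s c v)" if g: "g \<in> carrier G" for g
        using ub[OF g, of "s c v"] pull[OF g] by (simp add: is_norm_def)
      moreover have "0 < a c" using a False by (metis nonarch_abs_def order_le_less)
      ultimately have "\<alpha> v \<le> \<alpha> (s c v) / a c"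
        by (intro lub) (simp add: le_divide_eq mult.commute)
      then show ?thesis using \<open>0 < a c\<close> by (simp add: le_divide_eq mult.commute)
    qed
  qed
  have add: "\<alpha> (v + w) \<le> max (\<alpha> v) (\<alpha> w)" for v w
  proof (rule lub)
    fix g assume g: "g \<in> carrier G"
    have "\<alpha>0 (\<rho> g (v + w)) \<le> max (\<alpha>0 (\<rho> g v)) (\<alpha>0 (\<rho> g w))"
      using pull[OF g] by (simp add: is_norm_def)
    also have "\<dots> \<le> max (\<alpha> v) (\<alpha> w)" using ub[OF g] by (intro max.mono)
    finally show "\<alpha>0 (\<rho> g (v + w)) \<le> max (\<alpha> v) (\<alpha> w)" .
  qed
  have "v = 0" if "\<alpha> v = 0" for v
    using lo[of v] that is_norm_pos[OF \<alpha>0, of v] by force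
  with nonneg scale add have n: "is_norm a s \<alpha>" by (simp add: is_norm_def)
  have "1 * \<alpha> v \<le> exp C * \<alpha> v" for v using C nonneg by (intro mult_right_mono) auto
  then have "\<alpha>0 v \<le> exp C * \<alpha> v" for v using order_trans[OF lo] by simp
  moreover have "\<alpha> v \<le> exp C * \<alpha>0 v" for v using lub up by blast
  ultimately have "dist_inf \<alpha> \<alpha>0 \<le> ennreal C"
    using C is_norm_pos[OF n] is_norm_pos[OF \<alpha>0] is_norm_zero[OF a V n] is_norm_zero[OF a V \<alpha>0]
    by (subst dist_inf_le_iff) auto
  then show "sup_norm G \<rho> \<alpha>0 \<in> finite_distance_component a s \<alpha>0"
    using n C unfolding \<alpha>_def finite_distance_component_def ennreal_finite_iff by blast
  \<comment> \<open>One inequality for every group element suffices: the other is its instance at the inverse.\<close>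
  have le: "\<alpha> (\<rho> h v) \<le> \<alpha> v" if h: "h \<in> carrier G" for h v
  proof (rule lub)
    fix g assume g: "g \<in> carrier G"
    have "\<rho> g (\<rho> h v) = \<rho> (g \<otimes>\<^bsub>G\<^esub> h) v" using \<rho> g h by (simp add: linear_representation_def)
    then show "\<alpha>0 (\<rho> g (\<rho> h v)) \<le> \<alpha> v" using ub g h by simp
  qed
  have "\<alpha> (\<rho> (inv\<^bsub>G\<^esub> g) v) = \<alpha> v" if g: "g \<in> carrier G" for g v
  proof (rule antisym)
    show "\<alpha> v \<le> \<alpha> (\<rho> (inv\<^bsub>G\<^esub> g) v)"
      using le[OF g, of "\<rho> (inv\<^bsub>G\<^esub> g) v"] linear_representation_inverse[OF G \<rho> inv_closed[OF g]] g by simp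
  qed (use le g in simp)
  then show "\<forall>g\<in>carrier G. norm_action G \<rho> g (sup_norm G \<rho> \<alpha>0) = sup_norm G \<rho> \<alpha>0"
    by (auto simp: norm_action_def \<alpha>_def)
qed

theorem theorem1p1:
  fixes \<iota>F :: "'p :: prime_card padic \<Rightarrow> 'f :: field"
    and \<iota>E :: "'p padic \<Rightarrow> 'e :: field"
    and absF :: "'f \<Rightarrow> real" and absE :: "'e \<Rightarrow> real"
    and S :: "('n :: finite \<times> 'n, 'f) mpoly set"
    and sA :: "'e \<Rightarrow> 'a :: ab_group_add \<Rightarrow> 'a" and \<pi> :: "'f ^ 'n ^ 'n \<Rightarrow> 'a \<Rightarrow> 'a"
    and sB :: "'e \<Rightarrow> 'b :: ab_group_add \<Rightarrow> 'b" and \<sigma> :: "'f ^ 'n ^ 'n \<Rightarrow> 'b \<Rightarrow> 'b"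
    and sV :: "'e \<Rightarrow> 'v :: ab_group_add \<Rightarrow> 'v" and \<rho> :: "'f ^ 'n ^ 'n \<Rightarrow> 'v \<Rightarrow> 'v"
    and t :: "'a \<Rightarrow> 'b \<Rightarrow> 'v" and \<alpha>0 :: "'v \<Rightarrow> real"
  assumes "finite_padic_extension \<iota>F" and "finite_padic_extension \<iota>E"
    and "nonarch_abs absF" and "\<And>x. absF (\<iota>F x) = padic_abs x"
    and "nonarch_abs absE" and "nontrivial_abs absE"
    and "reductive_group S"
    and "linear_representation (rational_points S) sA \<pi>"
    and "smooth (matrix_topology absF (carrier (rational_points S))) (rational_points S) \<pi>"
    and "admissible (matrix_topology absF (carrier (rational_points S))) (rational_points S) sA \<pi>"
    and "algebraic_representation \<iota>F \<iota>E S sB \<sigma>"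
    and "is_tensor_product sA sB sV t"
    and "diagonal_action (rational_points S) sV t \<pi> \<sigma> \<rho>"
    and "is_norm absE sV \<alpha>0"
  shows "(\<exists>\<alpha>\<in>finite_distance_component absE sV \<alpha>0.
      \<forall>g\<in>carrier (rational_points S). norm_action (rational_points S) \<rho> g \<alpha> = \<alpha>) \<longleftrightarrow>
    (SUP g\<in>carrier (rational_points S). dist_inf \<alpha>0 (norm_action (rational_points S) \<rho> g \<alpha>0)) < \<infinity>"
proof -
  have G: "group (rational_points S)"
    using assms(7) by (simp add: reductive_group_def rational_points_group)
  have "linear_representation (rational_points S) sB \<sigma>"
    using assms(11) by (simp add: algebraic_representation_def)
  then have \<rho>: "linear_representation (rational_points S) sV \<rho>"
    using diagonal_action_linear_representation[OF G assms(8) _ assms(12,13)] by blast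
  show ?thesis
    using invariant_norm_imp_bounded_orbit[OF G \<rho> assms(5,14)]
      bounded_orbit_imp_invariant_norm[OF G \<rho> assms(5,14)] by blast
qed

end
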